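(* Suppose that the linking variables are binary, i.e. $x_L\in\{0,1\}^L$ for every $(x,y)\in\mathcal{F}$. Let $\gamma\in\{0,1\}^L$. Then $$\sum_{i\in L:\,\gamma_i=0}x_i+\sum_{i\in L:\,\gamma_i=1}(1-x_i)\ge1\qquad\text{for all }(x,y)\in\mathcal{F}\text{ such that }x_L\ne\gamma .$$ Furthermore, this inequality is violated by all $(x,y)\in\mathcal{P}$ with $x_L=\gamma$.
   Context: Setting (mixed integer bilevel linear optimization). Let $X=\mathbb{Z}^{r_1}_+\times\mathbb{R}^{n_1-r_1}_+$ and $Y=\mathbb{Z}^{r_2}_+\times\mathbb{R}^{n_2-r_2}_+$ with $0\le r_1\le n_1$, $0\le r_2\le n_2$. The data are rational: $A^1\in\mathbb{Q}^{m_1\times n_1}$, $G^1\in\mathbb{Q}^{m_1\times n_2}$, $b^1\in\mathbb{Q}^{m_1}$, $A^2\in\mathbb{Q}^{m_2\times n_1}$, $G^2\in\mathbb{Q}^{m_2\times n_2}$, $b^2\in\mathbb{Q}^{m_2}$, $d^2\in\mathbb{Q}^{n_2}$. The index set of the linking variables is $L=\{i\in\{1,\dots,n_1\}\mid A^2_i\ne0\}$, where $A^2_i$ is the $i$-th column of $A^2$, and $x_L$ denotes the subvector of $x$ indexed by $L$. For $x\in\mathbb{R}^{n_1}$ put $$\mathcal{P}_1(x)=\{y\in\mathbb{R}^{n_2}_+\mid G^1y\ge b^1-A^1x\},\qquad \mathcal{P}_2(x)=\{y\in\mathbb{R}^{n_2}_+\mid G^2y\ge b^2-A^2x\},$$ $$\mathcal{P}=\{(x,y)\in\mathbb{R}^{n_1+n_2}_+\mid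 y\in\mathcal{P}_1(x)\cap\mathcal{P}_2(x)\}.$$ The rational reaction set is $\mathcal{R}(x)=\operatorname{argmin}\{d^2y\mid y\in\mathcal{P}_2(x)\cap Y\}$, and the bilevel feasible region is $$\mathcal{F}=\{(x,y)\in X\times Y\mid y\in\mathcal{P}_1(x)\cap\mathcal{R}(x)\}.$$ *)

theory Defs
  imports Complex_Main "HOL-Library.FuncSet" "Jordan_Normal_Form.Matrix"
begin

text \<open>
  Vectors and matrices are 0-based: a variable index ranges over \<open>{0..<n}\<close>, and the
  integer-constrained variables are those with index below \<open>r\<close>. The problem data are rational
  and are embedded into the reals, over which the decision vectors range.
\<close>

abbreviation real_mat :: "rat mat \<Rightarrow> real mat" where
  "real_mat \<equiv> map_mat real_of_rat"

abbreviation real_vec :: "rat vec \<Rightarrow> real vec" where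
  "real_vec \<equiv> map_vec real_of_rat"

definition nonneg_orthant :: "nat \<Rightarrow> real vec set" where
  "nonneg_orthant n = {x \<in> carrier_vec n. 0\<^sub>v n \<le> x}"

definition mixed_integer_orthant :: "nat \<Rightarrow> nat \<Rightarrow> real vec set" where
  "mixed_integer_orthant r n = {x \<in> nonneg_orthant n. \<forall>i<r. x $ i \<in> \<int>}"

text \<open>
  The set \<open>{y \<ge> 0 | G y \<ge> b - A x}\<close>. It serves as \<open>\<P>\<^sub>1(x)\<close> with the
  data \<open>A\<^sup>1, G\<^sup>1, b\<^sup>1\<close> and as \<open>\<P>\<^sub>2(x)\<close> with the data \<open>A\<^sup>2, G\<^sup>2, b\<^sup>2\<close>.
\<close>

definition level_polyhedron :: "nat \<Rightarrow> rat mat \<Rightarrow> rat mat \<Rightarrow> rat vec \<Rightarrow> real vec \<Rightarrow> real vec set" where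
  "level_polyhedron n2 A G b x =
     {y \<in> nonneg_orthant n2. real_vec b - real_mat A *\<^sub>v x \<le> real_mat G *\<^sub>v y}"

definition relaxation_polyhedron ::
  "nat \<Rightarrow> nat \<Rightarrow> rat mat \<Rightarrow> rat mat \<Rightarrow> rat vec \<Rightarrow> rat mat \<Rightarrow> rat mat \<Rightarrow> rat vec
     \<Rightarrow> (real vec \<times> real vec) set" where
  "relaxation_polyhedron n1 n2 A1 G1 b1 A2 G2 b2 =
     {(x, y). x \<in> nonneg_orthant n1 \<and> y \<in> nonneg_orthant n2 \<and>
        y \<in> level_polyhedron n2 A1 G1 b1 x \<inter> level_polyhedron n2 A2 G2 b2 x}"

definition reaction_set ::
  "nat \<Rightarrow> nat \<Rightarrow> rat mat \<Rightarrow> rat mat \<Rightarrow> rat vec \<Rightarrow> rat vec \<Rightarrow> real vec \<Rightarrow> real vec set" where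
  "reaction_set r2 n2 A2 G2 b2 d2 x =
     {y. is_arg_min (\<lambda>z. real_vec d2 \<bullet> z)
           (\<lambda>z. z \<in> level_polyhedron n2 A2 G2 b2 x \<inter> mixed_integer_orthant r2 n2) y}"

definition bilevel_feasible ::
  "nat \<Rightarrow> nat \<Rightarrow> nat \<Rightarrow> nat \<Rightarrow> rat mat \<Rightarrow> rat mat \<Rightarrow> rat vec \<Rightarrow> rat mat \<Rightarrow> rat mat \<Rightarrow> rat vec \<Rightarrow> rat vec
     \<Rightarrow> (real vec \<times> real vec) set" where
  "bilevel_feasible r1 n1 r2 n2 A1 G1 b1 A2 G2 b2 d2 =
     {(x, y). x \<in> mixed_integer_orthant r1 n1 \<and> y \<in> mixed_integer_orthant r2 n2 \<and>
        y \<in> level_polyhedron n2 A1 G1 b1 x \<inter> reaction_set r2 n2 A2 G2 b2 d2 x}"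

definition linking_indices :: "rat mat \<Rightarrow> nat set" where
  "linking_indices A2 = {i. i < dim_col A2 \<and> col A2 i \<noteq> 0\<^sub>v (dim_row A2)}"

text \<open>
  The subvector \<open>x\<^sub>L\<close> keeps its original indices: it is an extensional function on \<open>L\<close>, so that
  \<open>{0,1}\<^sup>L\<close> is the extensional function space \<open>L \<rightarrow>\<^sub>E {0, 1}\<close>.
\<close>

definition subvector :: "real vec \<Rightarrow> nat set \<Rightarrow> nat \<Rightarrow> real" where
  "subvector x L = restrict (\<lambda>i. x $ i) L"

end

theory Submission
  imports Defs
begin

text \<open>
  For two 0/1 vectors \<open>u\<close> and \<open>\<gamma>\<close>, the left-hand side of the inequality is the Hamming distance
  of \<open>u\<close> and \<open>\<gamma>\<close>: a coordinate contributes \<open>u i\<close> or \<open>1 - u i\<close>, and this is \<open>1\<close> where the vectors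
  differ and \<open>0\<close> where they agree (\<open>no_good_sum_eq_hamming_distance\<close>). The distance is a
  natural number that vanishes only for equal vectors, so it is at least \<open>1\<close> as soon as
  \<open>x\<^sub>L \<noteq> \<gamma>\<close>, and it is \<open>0\<close>, which violates the inequality, when \<open>x\<^sub>L = \<gamma>\<close>. That \<open>x\<^sub>L\<close> is
  binary comes from the hypothesis on feasible points in the first case and from
  \<open>\<gamma> \<in> {0, 1}\<^sup>L\<close> in the second.
\<close>

lemma finite_linking_indices: "finite (linking_indices A)"
  by (simp add: linking_indices_def)

text \<open>
  Coordinatewise, \<open>|u i - \<gamma> i|\<close> is affine in \<open>u i\<close> on \<open>[0, 1]\<close> once the bit \<open>\<gamma> i\<close> is fixed;
  this is why the Hamming distance to \<open>\<gamma>\<close> can serve as a linear cut.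
\<close>

lemma no_good_sum_eq_hamming_distance:
  fixes u \<gamma> :: "'i \<Rightarrow> 'a::linordered_idom"
  assumes "finite L" and u: "\<And>i. i \<in> L \<Longrightarrow> u i \<in> {0, 1}" and \<gamma>: "\<And>i. i \<in> L \<Longrightarrow> \<gamma> i \<in> {0, 1}"
  shows "(\<Sum>i \<in> {i \<in> L. \<gamma> i = 0}. u i) + (\<Sum>i \<in> {i \<in> L. \<gamma> i = 1}. 1 - u i)
           = of_nat (card {i \<in> L. u i \<noteq> \<gamma> i})"
proof -
  have "(\<Sum>i \<in> {i \<in> L. \<gamma> i = 0}. u i) + (\<Sum>i \<in> {i \<in> L. \<gamma> i = 1}. 1 - u i)
      = (\<Sum>i \<in> L. (if \<gamma> i = 0 then u i else 0) + (if \<gamma> i = 1 then 1 - u i else 0))"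
    using \<open>finite L\<close> by (simp add: sum.inter_filter sum.distrib)
  also have "\<dots> = (\<Sum>i \<in> L. if u i \<noteq> \<gamma> i then 1 else 0)"
    using u \<gamma> by (intro sum.cong) fastforce+
  also have "\<dots> = (\<Sum>i \<in> {i \<in> L. u i \<noteq> \<gamma> i}. 1)"
    using \<open>finite L\<close> by (rule sum.inter_filter[symmetric])
  finally show ?thesis by simp
qed

theorem theorem10:
  fixes r1 n1 r2 n2 m1 m2 :: nat
    and A1 G1 A2 G2 :: "rat mat"
    and b1 b2 d2 :: "rat vec"
    and \<gamma> :: "nat \<Rightarrow> real"
  assumes "r1 \<le> n1" and "r2 \<le> n2"
    and "A1 \<in> carrier_mat m1 n1" and "G1 \<in> carrier_mat m1 n2" and "b1 \<in> carrier_vec m1"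
    and "A2 \<in> carrier_mat m2 n1" and "G2 \<in> carrier_mat m2 n2" and "b2 \<in> carrier_vec m2"
    and "d2 \<in> carrier_vec n2"
    and linking_binary:
      "\<forall>(x, y) \<in> bilevel_feasible r1 n1 r2 n2 A1 G1 b1 A2 G2 b2 d2.
         subvector x (linking_indices A2) \<in> linking_indices A2 \<rightarrow>\<^sub>E {0, 1}"
    and "\<gamma> \<in> linking_indices A2 \<rightarrow>\<^sub>E {0, 1}"
  shows
    "(\<forall>(x, y) \<in> bilevel_feasible r1 n1 r2 n2 A1 G1 b1 A2 G2 b2 d2.
        subvector x (linking_indices A2) \<noteq> \<gamma> \<longrightarrow>
        (\<Sum>i \<in> {i \<in> linking_indices A2. \<gamma> i = 0}. x $ i)
          + (\<Sum>i \<in> {i \<in> linking_indices A2. \<gamma> i = 1}. 1 - x $ i) \<ge> 1) \<and>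
     (\<forall>(x, y) \<in> relaxation_polyhedron n1 n2 A1 G1 b1 A2 G2 b2.
        subvector x (linking_indices A2) = \<gamma> \<longrightarrow>
        \<not> (\<Sum>i \<in> {i \<in> linking_indices A2. \<gamma> i = 0}. x $ i)
          + (\<Sum>i \<in> {i \<in> linking_indices A2. \<gamma> i = 1}. 1 - x $ i) \<ge> 1)"
proof -
  let ?L = "linking_indices A2"
  have hamming: "(\<Sum>i \<in> {i \<in> ?L. \<gamma> i = 0}. x $ i) + (\<Sum>i \<in> {i \<in> ?L. \<gamma> i = 1}. 1 - x $ i)
      = real (card {i \<in> ?L. x $ i \<noteq> \<gamma> i})"
    if "subvector x ?L \<in> ?L \<rightarrow>\<^sub>E {0, 1}" for x
  proof (rule no_good_sum_eq_hamming_distance[OF finite_linking_indices])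
    show "x $ i \<in> {0, 1}" if "i \<in> ?L" for i
      using PiE_mem[OF \<open>subvector x ?L \<in> _\<close> that] that by (simp add: subvector_def)
    show "\<gamma> i \<in> {0, 1}" if "i \<in> ?L" for i
      using PiE_mem[OF \<open>\<gamma> \<in> _\<close> that] .
  qed
  \<comment> \<open>Both vectors are extensional on \<open>L\<close>, so they are equal iff they agree on \<open>L\<close>.\<close>
  have subvector_eq_iff: "subvector x ?L = \<gamma> \<longleftrightarrow> {i \<in> ?L. x $ i \<noteq> \<gamma> i} = {}" for x
    using \<open>\<gamma> \<in> _\<close> by (auto simp: subvector_def fun_eq_iff restrict_def PiE_def extensional_def)
  have card_pos: "1 \<le> real (card {i \<in> ?L. x $ i \<noteq> \<gamma> i})" if "subvector x ?L \<noteq> \<gamma>" for x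
  proof -
    have "card {i \<in> ?L. x $ i \<noteq> \<gamma> i} \<noteq> 0"
      using that finite_linking_indices[of A2] unfolding subvector_eq_iff by simp
    then show ?thesis by linarith
  qed
  have violated: "\<not> 1 \<le> (\<Sum>i \<in> {i \<in> ?L. \<gamma> i = 0}. x $ i) + (\<Sum>i \<in> {i \<in> ?L. \<gamma> i = 1}. 1 - x $ i)"
    if "subvector x ?L = \<gamma>" for x
  proof -
    have "subvector x ?L \<in> ?L \<rightarrow>\<^sub>E {0, 1}"
      using that \<open>\<gamma> \<in> _\<close> by simp
    moreover have "{i \<in> ?L. x $ i \<noteq> \<gamma> i} = {}"
      using that by (simp only: subvector_eq_iff)
    ultimately show ?thesis
      by (simp only: hamming) simp
  qed
  have valid: "1 \<le> (\<Sum>i \<in> {i \<in> ?L. \<gamma> i = 0}. x $ i) + (\<Sum>i \<in> {i \<in> ?L. \<gamma> i = 1}. 1 - x $ i)"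
    if "(x, y) \<in> bilevel_feasible r1 n1 r2 n2 A1 G1 b1 A2 G2 b2 d2" "subvector x ?L \<noteq> \<gamma>" for x y
  proof -
    have "subvector x ?L \<in> ?L \<rightarrow>\<^sub>E {0, 1}"
      using linking_binary that(1) by blast
    then show ?thesis
      using card_pos[OF that(2)] by (simp only: hamming)
  qed
  from valid violated show ?thesis by blast
qed

end
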